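(* Every indecomposable interval $I$ in a Tamari lattice is either $[\mathsf{Y},\mathsf{Y}]$ or of the form $\mathsf{Y}*_sJ$ for some interval $J$ and some segment $s$ of the left border of $\max(J)$, and $J$ and $s$ are uniquely determined.
   Context: Planar binary trees have internal vertices of valence $3$, a root at the bottom and leaves at the top. $Y_n$ is the set of planar binary trees with $n\ge1$ internal vertices; $\mathsf{Y}$ is the unique element of $Y_1$; $|$ is the trivial tree with one leaf and no internal vertex. $S\vee T$ is the tree whose bottom internal vertex has left subtree $S$ and right subtree $T$ ($S,T$ possibly trivial). $S/T$ is obtained by identifying the root of $S$ with the leftmost leaf of $T$; $S\backslash T$ by identifying the root of $T$ with the rightmost leaf of $S$. Tamari order on $Y_n$: $S\leq T$ iff one can pass from $S$ to $T$ by a (possibly empty) sequence of replacements of a subtree $A\vee(B\vee C)$ by $(A\vee B)\vee C$ ($A,B,C$ possibly trivial). An interval in $Y_n$ ($n\ge1$) is $[S,T]$ with $S\le T$ in $Y_n$; its minimum is $S$ and its maximum is $T$. For intervals $J,K$, $J/K$ is the interval with $\min(J/K)=\min(J)/\min(K)$ and $\max(J/K)=\max(J)/\max(K)$. An interval is indecomposable if it is not of the form $J/K$ with $J$ in $Y_m$, $K$ in $Y_n$, $m,n\ge1$. The segments of the left border of a tree $T$ are the edges on the path from the root to the leftmost leaf, both the root edge and the leftmost leaf edge included (so $\mathsf{Y}$ has $2$ of them). For an interval $J$ and a segment $s$ of the left border of $\max(J)$, the interval $\mathsf{Y}*_sJ$ is defined by: $\min(\mathsf{Y}*_sJ)=\mathsf{Y}\backslash\min(J)$,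 i.e. $|\vee\min(J)$; and $\max(\mathsf{Y}*_sJ)$ is obtained from $\max(J)$ by adding on the left an edge attached to the middle of $s$, i.e. by replacing the subtree $U$ (possibly trivial) situated above $s$ by $|\vee U$. *)

theory Defs
  imports "HOL-Library.Tree"
begin

text \<open>
  A planar binary tree is an unlabelled \<open>'a tree\<close>: \<^const>\<open>Leaf\<close> is the trivial tree \<open>|\<close>, a node is
  an internal (trivalent) vertex, and \<^const>\<open>size\<close> counts the internal vertices.
\<close>

type_synonym pbtree = "unit tree"

abbreviation wedge :: "pbtree \<Rightarrow> pbtree \<Rightarrow> pbtree"
  where "wedge S T \<equiv> Node S () T"

definition Y_trees :: "nat \<Rightarrow> pbtree set"
  where "Y_trees n = {T. size T = n}"

definition Y_tree :: pbtree
  where "Y_tree = wedge Leaf Leaf"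

text \<open>\<open>over S T\<close> is \<open>S / T\<close> and \<open>under S T\<close> is \<open>S \ T\<close>.\<close>

primrec over :: "pbtree \<Rightarrow> pbtree \<Rightarrow> pbtree" where
  "over S Leaf = S"
| "over S (Node L u R) = Node (over S L) u R"

primrec under :: "pbtree \<Rightarrow> pbtree \<Rightarrow> pbtree" where
  "under Leaf T = T"
| "under (Node L u R) T = Node L u (under R T)"

text \<open>One replacement of a subtree \<open>A \<or> (B \<or> C)\<close>, at any place, by \<open>(A \<or> B) \<or> C\<close>.\<close>

inductive rotation :: "pbtree \<Rightarrow> pbtree \<Rightarrow> bool" where
  root: "rotation (wedge A (wedge B C)) (wedge (wedge A B) C)"
| left: "rotation L L' \<Longrightarrow> rotation (wedge L R) (wedge L' R)"
| right: "rotation R R' \<Longrightarrow> rotation (wedge L R) (wedge L R')"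

definition tamari_le :: "pbtree \<Rightarrow> pbtree \<Rightarrow> bool"
  where "tamari_le = rotation\<^sup>*\<^sup>*"

text \<open>The interval \<open>[S, T]\<close> is represented by the pair of its minimum and its maximum.\<close>

type_synonym interval = "pbtree \<times> pbtree"

abbreviation imin :: "interval \<Rightarrow> pbtree" where "imin \<equiv> fst"
abbreviation imax :: "interval \<Rightarrow> pbtree" where "imax \<equiv> snd"

definition intervals_in :: "nat \<Rightarrow> interval set"
  where "intervals_in n =
    {I. imin I \<in> Y_trees n \<and> imax I \<in> Y_trees n \<and> tamari_le (imin I) (imax I)}"

definition intervals :: "interval set"
  where "intervals = (\<Union>n\<in>{1..}. intervals_in n)"

definition interval_over :: "interval \<Rightarrow> interval \<Rightarrow> interval"
  where "interval_over J K = (over (imin J) (imin K), over (imax J) (imax K))"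

definition indecomposable :: "interval \<Rightarrow> bool"
  where "indecomposable I \<longleftrightarrow>
    I \<in> intervals \<and> \<not> (\<exists>J\<in>intervals. \<exists>K\<in>intervals. I = interval_over J K)"

text \<open>
  The segments of the left border are numbered from the root upwards: segment \<open>0\<close> is the root edge
  and segment \<open>left_border_length T\<close> is the leftmost leaf edge.
\<close>

primrec left_border_length :: "pbtree \<Rightarrow> nat" where
  "left_border_length Leaf = 0"
| "left_border_length (Node L u R) = Suc (left_border_length L)"

definition left_segments :: "pbtree \<Rightarrow> nat set"
  where "left_segments T = {0..left_border_length T}"

text \<open>
  \<open>attach_left s T\<close> replaces the subtree \<open>U\<close> of \<open>T\<close> above segment \<open>s\<close> of the left border by \<open>| \<or> U\<close>.
  The last equation is a dummy: there \<open>Suc s\<close> is not a segment.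
\<close>

fun attach_left :: "nat \<Rightarrow> pbtree \<Rightarrow> pbtree" where
  "attach_left 0 U = wedge Leaf U"
| "attach_left (Suc s) (Node L u R) = Node (attach_left s L) u R"
| "attach_left (Suc s) Leaf = Leaf"

text \<open>\<open>Y_star s J\<close> is \<open>Y *\<^sub>s J\<close>, meaningful for \<open>s \<in> left_segments (imax J)\<close>.\<close>

definition Y_star :: "nat \<Rightarrow> interval \<Rightarrow> interval"
  where "Y_star s J = (under Y_tree (imin J), attach_left s (imax J))"

end

theory Submission imports Defs begin

text \<open>
  Removing the leftmost leaf of a nontrivial tree, together with the edge attached to it, undoes
  \<^const>\<open>attach_left\<close>, and the segment to which this edge was attached can be read off from the length
  of the left border (\<open>attach_left_prune_left\<close>, \<open>prune_left_attach_left\<close>,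
  \<open>left_border_length_attach_left\<close>). So every nontrivial tree is \<open>attach_left s U\<close> for exactly one
  tree \<open>U\<close> and one segment \<open>s\<close> of its left border, and an interval \<open>[S, T]\<close> is of the form
  \<open>Y *\<^sub>s J\<close> for at most one \<open>J\<close> and \<open>s\<close>. For such a \<open>J\<close> to exist, two things are needed: \<open>S\<close> must be
  \<open>| \<or> S'\<close> for some \<open>S'\<close>, and pruning \<open>T\<close> must give a tree above \<open>S'\<close>. Then \<open>J\<close> has minimum \<open>S'\<close>
  and the pruned \<open>T\<close> as maximum, unless \<open>S'\<close> is trivial, which is the case of \<open>[Y, Y]\<close>.

  The second point holds because pruning is monotone for the Tamari order
  (\<open>tamari_le_prune_left\<close>) and turns \<open>| \<or> S'\<close> into \<open>S'\<close>.

  The first point is where indecomposability enters. A tree \<open>A \<or> B\<close> with \<open>A\<close> nontrivial is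
  \<open>A / (| \<or> B)\<close>, and a factorization of the form \<open>P / Q\<close> survives every move up in the
  Tamari order (\<open>tamari_le_over\<close>): each rotation of \<open>P / Q\<close> is one of \<open>P\<close> or one
  of \<open>Q\<close>. Hence a factorization of the minimum carries over to the whole interval.
\<close>

lemma size_rotation: "rotation S T \<Longrightarrow> size T = size S"
  by (induction rule: rotation.induct) auto

lemma rotation_neq_Leaf: "rotation S T \<Longrightarrow> S \<noteq> Leaf \<and> T \<noteq> Leaf"
  by (induction rule: rotation.induct) auto

lemma size_tamari_le: "tamari_le S T \<Longrightarrow> size T = size S"
  unfolding tamari_le_def by (induction rule: rtranclp_induct) (auto simp: size_rotation)

lemma intervals_iff: "I \<in> intervals \<longleftrightarrow> imin I \<noteq> Leaf \<and> tamari_le (imin I) (imax I)"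
proof -
  have "Suc 0 \<le> size S \<longleftrightarrow> S \<noteq> Leaf" for S :: pbtree
    by (cases S) auto
  then show ?thesis
    by (auto simp: intervals_def intervals_in_def Y_trees_def dest: size_tamari_le)
qed

text \<open>
  A rotation takes place along an edge from a vertex to its right child. In \<open>A / B\<close> such an edge
  lies within one of the two factors, since the edge that joins them ends at a left child. A rotation
  of \<open>B\<close> moves \<open>A\<close> along with the leftmost leaf of \<open>B\<close>, without opening it.
\<close>
lemma rotation_over:
  assumes "rotation (over A B) T"
  shows "(\<exists>A'. rotation A A' \<and> T = over A' B) \<or> (\<exists>B'. rotation B B' \<and> T = over A B')"
  using assms
proof (induction B arbitrary: T)
  case Leaf
  then show ?case by auto
next
  case (Node L u R)
  from Node.prems have "rotation (Node (over A L) u R) T" by simp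
  then show ?case
  proof cases
    case (root B C)
    have "rotation (Node L u R) (wedge (wedge L B) C)"
      using root by (auto intro: rotation.root)
    moreover have "T = over A (wedge (wedge L B) C)"
      using root by simp
    ultimately show ?thesis by blast
  next
    case (left L')
    from Node.IH(1)[OF left(3)] show ?thesis
    proof (elim disjE exE conjE)
      fix A' assume "rotation A A'" "L' = over A' L"
      then show ?thesis using left by auto
    next
      fix L'' assume "rotation L L''" "L' = over A L''"
      then have "rotation (Node L u R) (wedge L'' R)" "T = over A (wedge L'' R)"
        using left by (auto intro: rotation.left)
      then show ?thesis by blast
    qed
  next
    case (right R')
    have "rotation (Node L u R) (wedge L R')" "T = over A (wedge L R')"
      using right by (auto intro: rotation.right)
    then show ?thesis by blast
  qed
qed

lemma tamari_le_over:
  assumes "tamari_le (over A B) T"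
  shows "\<exists>A' B'. tamari_le A A' \<and> tamari_le B B' \<and> T = over A' B'"
  using assms unfolding tamari_le_def
proof (induction rule: rtranclp_induct)
  case base
  then show ?case by blast
next
  case (step T T')
  from step.IH obtain A' B'
    where A': "rotation\<^sup>*\<^sup>* A A'" and B': "rotation\<^sup>*\<^sup>* B B'" and T: "T = over A' B'"
    by blast
  from rotation_over[OF step.hyps(2)[unfolded T]] show ?case
  proof (elim disjE exE conjE)
    fix A'' assume "rotation A' A''" "T' = over A'' B'"
    then show ?thesis
      using rtranclp.rtrancl_into_rtrancl[OF A'] B' by blast
  next
    fix B'' assume "rotation B' B''" "T' = over A' B''"
    then show ?thesis
      using rtranclp.rtrancl_into_rtrancl[OF B'] A' by blast
  qed
qed

lemma indecomposable_left_Leaf: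
  assumes "indecomposable (Node A u B, T)"
  shows "A = Leaf"
proof (rule ccontr)
  assume "A \<noteq> Leaf"
  have "tamari_le (over A (Node Leaf u B)) T"
    using assms by (simp add: indecomposable_def intervals_iff)
  then obtain P Q where *: "tamari_le A P" "tamari_le (Node Leaf u B) Q" "T = over P Q"
    using tamari_le_over by blast
  have "(A, P) \<in> intervals" "(Node Leaf u B, Q) \<in> intervals"
    using * \<open>A \<noteq> Leaf\<close> by (simp_all add: intervals_iff)
  moreover have "(Node A u B, T) = interval_over (A, P) (Node Leaf u B, Q)"
    using * by (simp add: interval_over_def)
  ultimately show False
    using assms unfolding indecomposable_def by blast
qed

primrec prune_left :: "pbtree \<Rightarrow> pbtree" where
  "prune_left Leaf = Leaf"
| "prune_left (Node L u R) = (if L = Leaf then R else Node (prune_left L) u R)"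

lemma attach_left_neq_Leaf: "s \<le> left_border_length T \<Longrightarrow> attach_left s T \<noteq> Leaf"
  by (induction s T rule: attach_left.induct) auto

lemma prune_left_attach_left:
  "s \<le> left_border_length T \<Longrightarrow> prune_left (attach_left s T) = T"
  by (induction s T rule: attach_left.induct) (auto simp: attach_left_neq_Leaf)

lemma left_border_length_attach_left:
  "s \<le> left_border_length T \<Longrightarrow> left_border_length (attach_left s T) = Suc s"
  by (induction s T rule: attach_left.induct) auto

lemma left_border_length_prune_left: "left_border_length T - 1 \<le> left_border_length (prune_left T)"
  by (induction T) auto

lemma attach_left_prune_left:
  "T \<noteq> Leaf \<Longrightarrow> attach_left (left_border_length T - 1) (prune_left T) = T"
proof (induction T)
  case (Node L u R)
  show ?case
  proof (cases "L = Leaf")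
    case False
    then have "left_border_length L = Suc (left_border_length L - 1)"
      by (cases L) simp_all
    then have "attach_left (left_border_length L) (Node (prune_left L) u R) =
        Node (attach_left (left_border_length L - 1) (prune_left L)) u R"
      by (metis attach_left.simps(2))
    then show ?thesis using False Node.IH(1) by simp
  qed simp
qed simp

text \<open>
  A rotation at the vertex \<open>|\<close> \<open>\<or> (B \<or> C)\<close> carrying the leftmost leaf becomes invisible after pruning:
  both sides turn into \<open>B \<or> C\<close>. Every other rotation remains a rotation.
\<close>
lemma rotation_prune_left:
  "rotation S T \<Longrightarrow> prune_left S = prune_left T \<or> rotation (prune_left S) (prune_left T)"
  by (induction rule: rotation.induct) (auto intro: rotation.intros dest: rotation_neq_Leaf)

lemma tamari_le_prune_left: "tamari_le S T \<Longrightarrow> tamari_le (prune_left S) (prune_left T)"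
  unfolding tamari_le_def
proof (induction rule: rtranclp_induct)
  case (step T U)
  then show ?case
    using rotation_prune_left[of T U] by (metis rtranclp.rtrancl_into_rtrancl)
qed simp

theorem proposition5p1:
  fixes I :: interval
  assumes "indecomposable I"
  shows "I = (Y_tree, Y_tree) \<or>
    (\<exists>!(J, s). J \<in> intervals \<and> s \<in> left_segments (imax J) \<and> I = Y_star s J)"
proof -
  obtain S T where I: "I = (S, T)" by fastforce
  have "S \<noteq> Leaf" and le: "tamari_le S T"
    using assms by (simp_all add: I indecomposable_def intervals_iff)
  then obtain S' where S: "S = wedge Leaf S'"
    using assms indecomposable_left_Leaf I by (cases S) auto
  have "T \<noteq> Leaf"
    using size_tamari_le[OF le] S by auto
  \<comment> \<open>The leftmost leaf edge of \<open>T\<close> is segment \<open>left_border_length T\<close>, attached at the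
    upper end of the preceding segment, which is the lower half of segment \<open>s\<close> of \<open>T'\<close>.\<close>
  define T' s where "T' = prune_left T" and "s = left_border_length T - 1"
  have T: "T = attach_left s T'" and s: "s \<in> left_segments T'"
    using attach_left_prune_left[OF \<open>T \<noteq> Leaf\<close>] left_border_length_prune_left[of T]
    by (simp_all add: T'_def s_def left_segments_def)
  have le': "tamari_le S' T'"
    using tamari_le_prune_left[OF le] by (simp add: S T'_def)
  show ?thesis
  proof (cases "S' = Leaf")
    case True
    then have "T' = Leaf"
      using size_tamari_le[OF le'] by simp
    then have "s = 0"
      using s by (simp add: left_segments_def)
    then show ?thesis
      using True \<open>T' = Leaf\<close> by (simp add: I S T Y_tree_def)
  next
    case False
    have "\<exists>!p. case p of (J, s) \<Rightarrow>
        J \<in> intervals \<and> s \<in> left_segments (imax J) \<and> I = Y_star s J"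
    proof (rule ex1I[of _ "((S', T'), s)"])
      show "case ((S', T'), s) of (J, s) \<Rightarrow>
          J \<in> intervals \<and> s \<in> left_segments (imax J) \<and> I = Y_star s J"
        using False le' s by (simp add: intervals_iff Y_star_def Y_tree_def I S T)
    next
      fix p :: "interval \<times> nat"
      assume p: "case p of (J, s) \<Rightarrow>
          J \<in> intervals \<and> s \<in> left_segments (imax J) \<and> I = Y_star s J"
      obtain A B t where [simp]: "p = ((A, B), t)" by (metis prod.exhaust)
      have t: "t \<le> left_border_length B" and "A = S'" and B: "T = attach_left t B"
        using p by (auto simp: left_segments_def Y_star_def Y_tree_def I S)
      moreover have "B = T'"
        using t by (simp add: T'_def B prune_left_attach_left)
      moreover have "t = s"
        using t by (simp add: s_def B left_border_length_attach_left)
      ultimately show "p = ((S', T'), s)" by simp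
    qed
    then show ?thesis by blast
  qed
qed

end
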